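(* Let $p\ge 0$ be an integer, and let $L_1\subseteq L_2\subseteq\cdots\subseteq L_n=L$ and $K_1\subseteq K_2\subseteq\cdots\subseteq K_n=K$ be filtrations of finite simplicial complexes $L$ and $K$ such that $L_i\subseteq K_i$ for all $1\le i\le n$. Assume $H_p(L)=0$ and $H_p(K)=0$. Fix barcode bases $A_L$ of $Z_p(L)$ and $A_K$ of $Z_p(K)$, and let $G$ be the graphcode determined by them, that is, the bipartite graph on $A_L\sqcup A_K$ in which $\alpha\in A_L$ and $\beta\in A_K$ are joined by an edge if and only if $\beta$ occurs with coefficient $1$ when $\alpha$, regarded as an element of $Z_p(K)$, is written as a linear combination of $A_K$. Then $A_L$, $A_K$ and $G$ (together with the bars of the basis elements) determine the homology maps $\phi_i:H_p(L_i)\to H_p(K_i)$ induced by the inclusions $L_i\subseteq K_i$, for all $1\le i\le n$, as follows. For each $i$, the classes $[\alpha]_{L_i}$ with $\alpha\in A_L$ alive at $i$ form a basis of $H_p(L_i)$; for each such $\alpha$, every neighbour $\beta\in A_K$ of $\alpha$ in $G$ is already born at $i$; and $$\phi_i\big([\alpha]_{L_i}\big)=\sum_{\substack{\beta\in A_K\text{ adjacent to }\alpha\text{ in }G\\ \beta\text{ alive at }i}}[\beta]_{K_i}.$$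
   Context: All homology is simplicial homology with $\mathbb{Z}_2$ coefficients; $Z_p(\cdot)$, $B_p(\cdot)$, $H_p(\cdot)=Z_p(\cdot)/B_p(\cdot)$ denote the spaces of $p$-cycles, $p$-boundaries and the $p$-th homology; $[\alpha]_X$ is the class in $H_p(X)$ of a cycle $\alpha\in Z_p(X)$. If $X\subseteq Y$ are complexes, $Z_p(X)$ is regarded as a subspace of $Z_p(Y)$. Let $X_1\subseteq\cdots\subseteq X_n=X$ be a filtration of a finite simplicial complex $X$ with $H_p(X)=0$. For $\alpha\in Z_p(X)$, the birth index of $\alpha$ is the minimal $i$ with $\alpha\in Z_p(X_\ell)$ for all $\ell\ge i$; the death index is the minimal $j$ with $\alpha\in B_p(X_\ell)$ for all $\ell\ge j$. The bar of $\alpha$ is the (possibly empty) half-open interval $[i,j)$. The cycle $\alpha$ is already born at $\ell$ if its birth index is at most $\ell$; it is alive at $\ell$ if it is already born at $\ell$ and $\ell$ is strictly smaller than its death index; it is dead at $\ell$ if its death index is at most $\ell$. A barcode basis of $Z_p(X)$ (for the given filtration) is a basis $A$ of the vector space $Z_p(X)$, each element carrying its bar, such that for every $i\in\{1,\dots,n\}$ the elements of $A$ dead at $i$ form a basis of $B_p(X_i)$ and the elements of $A$ already born at $i$ form a basis of $Z_p(X_i)$. *)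

theory Defs
  imports
    "Jordan_Normal_Form.VS_Connect"
    "HOL-Library.Poly_Mapping"
    "HOL-Library.Z2"
    "HOL-Algebra.AbelCoset"
begin

(* These default rules turn ring operations on bit into bit operations, defeating ring lemmas. *)
declare add_bit_eq_xor [simp del] mult_bit_eq_and [simp del]

section \<open>Simplicial complexes, filtrations and chains\<close>

definition simplicial_complex :: "'v set set \<Rightarrow> bool" where
  "simplicial_complex X \<longleftrightarrow>
     (\<forall>\<sigma>\<in>X. finite \<sigma> \<and> \<sigma> \<noteq> {}) \<and>
     (\<forall>\<sigma>\<in>X. \<forall>\<tau>. \<tau> \<subseteq> \<sigma> \<and> \<tau> \<noteq> {} \<longrightarrow> \<tau> \<in> X)"

text \<open>Only the values \<open>X 1, \<dots>, X n\<close> of the index function matter.\<close>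

definition filtration :: "nat \<Rightarrow> (nat \<Rightarrow> 'v set set) \<Rightarrow> bool" where
  "filtration n X \<longleftrightarrow>
     1 \<le> n \<and>
     (\<forall>i\<in>{1..n}. finite (X i) \<and> simplicial_complex (X i)) \<and>
     (\<forall>i\<in>{1..<n}. X i \<subseteq> X (Suc i))"

text \<open>
  Chains of all complexes on the vertex type \<open>'v\<close> live in one type, so that for \<open>X \<subseteq> Y\<close>
  a cycle of \<open>X\<close> literally is a cycle of \<open>Y\<close>.
\<close>

type_synonym 'v chain = "'v set \<Rightarrow>\<^sub>0 bit"

abbreviation Z2 :: "bit ring" where
  "Z2 \<equiv> class_ring"

definition p_chains :: "nat \<Rightarrow> 'v set set \<Rightarrow> 'v chain set" where
  "p_chains p X = {c. Poly_Mapping.keys c \<subseteq> {\<sigma> \<in> X. card \<sigma> = Suc p}}"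

text \<open>Unreduced convention: the boundary of a 0-chain is 0, so every 0-chain is a cycle.\<close>

definition boundary :: "nat \<Rightarrow> 'v chain \<Rightarrow> 'v chain" where
  "boundary p c =
     (if p = 0 then 0
      else \<Sum>\<sigma>\<in>Poly_Mapping.keys c. \<Sum>v\<in>\<sigma>.
             Poly_Mapping.single (\<sigma> - {v}) (Poly_Mapping.lookup c \<sigma>))"

definition cycles :: "nat \<Rightarrow> 'v set set \<Rightarrow> 'v chain set" where
  "cycles p X = {c \<in> p_chains p X. boundary p c = 0}"

definition boundaries :: "nat \<Rightarrow> 'v set set \<Rightarrow> 'v chain set" where
  "boundaries p X = boundary (Suc p) ` p_chains (Suc p) X"


section \<open>Cycle, boundary and homology spaces\<close>

text \<open>
  The fields \<open>mult\<close> and \<open>one\<close> of a module record carry no meaning for a vector space.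
\<close>

definition chain_module :: "'v chain set \<Rightarrow> (bit, 'v chain) module" where
  "chain_module C =
     \<lparr>carrier = C, mult = (\<lambda>_ _. 0), one = 0, zero = 0, add = (+),
      smult = (\<lambda>a. Poly_Mapping.map ((*) a))\<rparr>"

definition cycle_space :: "nat \<Rightarrow> 'v set set \<Rightarrow> (bit, 'v chain) module" where
  "cycle_space p X = chain_module (cycles p X)"

definition boundary_space :: "nat \<Rightarrow> 'v set set \<Rightarrow> (bit, 'v chain) module" where
  "boundary_space p X = chain_module (boundaries p X)"

definition quotient_module ::
  "('a, 'b) module \<Rightarrow> 'b set \<Rightarrow> ('a, 'b set) module" where
  "quotient_module M N =
     \<lparr>carrier = a_rcosets\<^bsub>M\<^esub> N, mult = (\<lambda>_ _. N), one = N, zero = N, add = set_add M,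
      smult = (\<lambda>a S. N <+>\<^bsub>M\<^esub> ((\<lambda>x. a \<odot>\<^bsub>M\<^esub> x) ` S))\<rparr>"

definition homology :: "nat \<Rightarrow> 'v set set \<Rightarrow> (bit, 'v chain set) module" where
  "homology p X = quotient_module (cycle_space p X) (boundaries p X)"

definition hclass :: "nat \<Rightarrow> 'v set set \<Rightarrow> 'v chain \<Rightarrow> 'v chain set" where
  "hclass p X \<alpha> = boundaries p X +>\<^bsub>cycle_space p X\<^esub> \<alpha>"

text \<open>
  The homology map of an inclusion \<open>X \<subseteq> Y\<close>: all representatives of a class of \<open>X\<close> have the
  same class in \<open>Y\<close>, and that class is the value (lemma \<open>induced_hclass\<close> below).
\<close>

definition induced ::
  "nat \<Rightarrow> 'v set set \<Rightarrow> 'v set set \<Rightarrow> 'v chain set \<Rightarrow> 'v chain set" where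
  "induced p X Y S = the_elem (hclass p Y ` S)"


section \<open>Bars and barcode bases\<close>

definition birth :: "nat \<Rightarrow> nat \<Rightarrow> (nat \<Rightarrow> 'v set set) \<Rightarrow> 'v chain \<Rightarrow> nat" where
  "birth p n X \<alpha> = (LEAST i. i \<in> {1..n} \<and> (\<forall>l\<in>{i..n}. \<alpha> \<in> cycles p (X l)))"

definition death :: "nat \<Rightarrow> nat \<Rightarrow> (nat \<Rightarrow> 'v set set) \<Rightarrow> 'v chain \<Rightarrow> nat" where
  "death p n X \<alpha> = (LEAST j. j \<in> {1..n} \<and> (\<forall>l\<in>{j..n}. \<alpha> \<in> boundaries p (X l)))"

definition already_born :: "nat \<Rightarrow> nat \<Rightarrow> (nat \<Rightarrow> 'v set set) \<Rightarrow> 'v chain \<Rightarrow> nat \<Rightarrow> bool" where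
  "already_born p n X \<alpha> l \<longleftrightarrow> birth p n X \<alpha> \<le> l"

definition alive :: "nat \<Rightarrow> nat \<Rightarrow> (nat \<Rightarrow> 'v set set) \<Rightarrow> 'v chain \<Rightarrow> nat \<Rightarrow> bool" where
  "alive p n X \<alpha> l \<longleftrightarrow> already_born p n X \<alpha> l \<and> l < death p n X \<alpha>"

definition dead :: "nat \<Rightarrow> nat \<Rightarrow> (nat \<Rightarrow> 'v set set) \<Rightarrow> 'v chain \<Rightarrow> nat \<Rightarrow> bool" where
  "dead p n X \<alpha> l \<longleftrightarrow> death p n X \<alpha> \<le> l"

definition barcode_basis :: "nat \<Rightarrow> nat \<Rightarrow> (nat \<Rightarrow> 'v set set) \<Rightarrow> 'v chain set \<Rightarrow> bool" where
  "barcode_basis p n X A \<longleftrightarrow>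
     vectorspace.basis Z2 (cycle_space p (X n)) A \<and>
     (\<forall>i\<in>{1..n}.
        vectorspace.basis Z2 (boundary_space p (X i)) {\<alpha> \<in> A. dead p n X \<alpha> i} \<and>
        vectorspace.basis Z2 (cycle_space p (X i)) {\<alpha> \<in> A. already_born p n X \<alpha> i})"


section \<open>The graphcode\<close>

definition coordinate ::
  "('a, 'c) ring_scheme \<Rightarrow> ('a, 'b) module \<Rightarrow> 'b set \<Rightarrow> 'b \<Rightarrow> 'b \<Rightarrow> 'a" where
  "coordinate F V A v =
     (THE a. a \<in> A \<rightarrow>\<^sub>E carrier F \<and> module.lincomb V a A = v)"

text \<open>
  A graph is a pair of a vertex set and a set of undirected edges \<open>{u, v}\<close>. The sum type keeps
  the two sides apart, since a chain may belong to both bases.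
\<close>

definition graphcode ::
  "nat \<Rightarrow> 'v set set \<Rightarrow> 'v chain set \<Rightarrow> 'v chain set \<Rightarrow>
     ('v chain + 'v chain) set \<times> ('v chain + 'v chain) set set" where
  "graphcode p K A_L A_K =
     (A_L <+> A_K,
      {{Inl \<alpha>, Inr \<beta>} | \<alpha> \<beta>.
         \<alpha> \<in> A_L \<and> \<beta> \<in> A_K \<and> coordinate Z2 (cycle_space p K) A_K \<alpha> \<beta> = 1})"

definition adjacent :: "'a set \<times> 'a set set \<Rightarrow> 'a \<Rightarrow> 'a \<Rightarrow> bool" where
  "adjacent G u v \<longleftrightarrow> {u, v} \<in> snd G"


section \<open>Well-formedness of the definitions\<close>

lemma chain_add_self: "c + c = (0 :: 'v chain)"
  by (rule poly_mapping_eqI) (simp add: lookup_add)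

lemma chain_uminus: "- c = (c :: 'v chain)"
  by (metis add_eq_0_iff chain_add_self)

lemma lookup_chain_smult:
  "Poly_Mapping.lookup (Poly_Mapping.map ((*) (a::bit)) c) x = a * Poly_Mapping.lookup c x"
  by (simp add: Poly_Mapping.map.rep_eq when_def)

lemma chain_smult_cases: "Poly_Mapping.map ((*) (a::bit)) c = (if a = 0 then 0 else c)"
  by (rule poly_mapping_eqI) (auto simp: lookup_chain_smult)

lemma vectorspace_chain_module:
  assumes "0 \<in> C" "\<And>x y. x \<in> C \<Longrightarrow> y \<in> C \<Longrightarrow> x + y \<in> C"
  shows "vectorspace Z2 (chain_module C)"
proof (rule vs_criteria)
  show "\<forall>v\<in>carrier (chain_module C). \<exists>neg_v\<in>carrier (chain_module C).
          v \<oplus>\<^bsub>chain_module C\<^esub> neg_v = \<zero>\<^bsub>chain_module C\<^esub>"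
    using chain_add_self by (simp add: chain_module_def) blast
qed (use assms in \<open>auto simp: chain_module_def class_field chain_smult_cases algebra_simps
        chain_add_self\<close>)

lemma boundary_eq_sum:
  assumes "finite S" "Poly_Mapping.keys c \<subseteq> S"
  shows "boundary p c =
     (if p = 0 then 0 else \<Sum>\<sigma>\<in>S. \<Sum>v\<in>\<sigma>.
        Poly_Mapping.single (\<sigma> - {v}) (Poly_Mapping.lookup c \<sigma>))"
proof -
  have "(\<Sum>\<sigma>\<in>Poly_Mapping.keys c. \<Sum>v\<in>\<sigma>.
          Poly_Mapping.single (\<sigma> - {v}) (Poly_Mapping.lookup c \<sigma>)) =
        (\<Sum>\<sigma>\<in>S. \<Sum>v\<in>\<sigma>. Poly_Mapping.single (\<sigma> - {v}) (Poly_Mapping.lookup c \<sigma>))"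
  proof (rule sum.mono_neutral_left[OF assms], rule ballI)
    fix \<sigma> assume "\<sigma> \<in> S - Poly_Mapping.keys c"
    then have "Poly_Mapping.lookup c \<sigma> = 0"
      by (simp add: not_in_keys_iff_lookup_eq_zero)
    then show "(\<Sum>v\<in>\<sigma>. Poly_Mapping.single (\<sigma> - {v}) (Poly_Mapping.lookup c \<sigma>)) = 0"
      by simp
  qed
  then show ?thesis
    unfolding boundary_def by presburger
qed

lemma boundary_add: "boundary p (c + d) = boundary p c + boundary p d"
proof -
  let ?S = "Poly_Mapping.keys c \<union> Poly_Mapping.keys d"
  have "Poly_Mapping.keys (c + d) \<subseteq> ?S"
    by (rule keys_add)
  then show ?thesis
    by (simp add: boundary_eq_sum[of ?S] lookup_add single_add sum.distrib)
qed

lemma boundary_zero: "boundary p 0 = 0"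
  by (simp add: boundary_def)

lemma boundary_sum: "boundary p (\<Sum>x\<in>A. f x) = (\<Sum>x\<in>A. boundary p (f x))"
  by (induction A rule: infinite_finite_induct) (simp_all add: boundary_zero boundary_add)

lemma boundary_single:
  "boundary p (Poly_Mapping.single \<sigma> a) =
     (if p = 0 then 0 else \<Sum>v\<in>\<sigma>. Poly_Mapping.single (\<sigma> - {v}) a)"
  by (subst boundary_eq_sum[of "{\<sigma>}"]) auto

lemma symmetric_double_sum_zero:
  fixes f :: "'a \<Rightarrow> 'a \<Rightarrow> 'v chain"
  assumes "finite A" "\<And>v w. f v w = f w v"
  shows "(\<Sum>v\<in>A. \<Sum>w\<in>A - {v}. f v w) = 0"
proof -
  define g where "g v w = (if v = w then 0 else f v w)" for v w
  have sym: "g v w = g w v" for v w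
    using assms(2) by (simp add: g_def)
  have "(\<Sum>w\<in>A - {v}. f v w) = (\<Sum>w\<in>A. g v w)" if "v \<in> A" for v
    using assms(1) that by (intro sum.mono_neutral_cong_left) (auto simp: g_def)
  then have "(\<Sum>v\<in>A. \<Sum>w\<in>A - {v}. f v w) = (\<Sum>v\<in>A. \<Sum>w\<in>A. g v w)"
    by simp
  also have "\<dots> = 0"
    using assms(1)
  proof induction
    case empty
    then show ?case by simp
  next
    case (insert a A)
    have "(\<Sum>v\<in>A. g v a) = (\<Sum>w\<in>A. g a w)"
      by (simp add: sym)
    moreover have "g a a = 0"
      by (simp add: g_def)
    ultimately show ?case
      using insert by (simp add: sum.distrib chain_add_self flip: add.assoc)
  qed
  finally show ?thesis .
qed

lemma boundary_boundary:
  assumes "c \<in> p_chains (Suc p) X"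
  shows "boundary p (boundary (Suc p) c) = 0"
proof (cases "p = 0")
  case False
  have "boundary p (boundary (Suc p) c) =
    (\<Sum>\<sigma>\<in>Poly_Mapping.keys c. \<Sum>v\<in>\<sigma>. \<Sum>w\<in>\<sigma> - {v}.
       Poly_Mapping.single (\<sigma> - {v} - {w}) (Poly_Mapping.lookup c \<sigma>))"
    using False by (simp add: boundary_def[of "Suc p"] boundary_sum boundary_single)
  also have "\<dots> = 0"
  proof (rule sum.neutral, rule ballI, rule symmetric_double_sum_zero)
    fix \<sigma> assume "\<sigma> \<in> Poly_Mapping.keys c"
    then have "card \<sigma> = Suc (Suc p)"
      using assms by (auto simp: p_chains_def)
    then show "finite \<sigma>"
      by (intro card_ge_0_finite) simp
  next
    fix \<sigma> v w
    show "Poly_Mapping.single (\<sigma> - {v} - {w}) (Poly_Mapping.lookup c \<sigma>) =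
          Poly_Mapping.single (\<sigma> - {w} - {v}) (Poly_Mapping.lookup c \<sigma>)"
      by (simp add: Diff_eq Int_ac)
  qed
  finally show ?thesis .
qed (simp add: boundary_def)

lemma zero_in_p_chains: "0 \<in> p_chains p X"
  by (simp add: p_chains_def)

lemma add_in_p_chains: "c \<in> p_chains p X \<Longrightarrow> d \<in> p_chains p X \<Longrightarrow> c + d \<in> p_chains p X"
  using keys_add[of c d] by (auto simp: p_chains_def)

lemma sum_in_p_chains: "(\<And>x. x \<in> A \<Longrightarrow> f x \<in> p_chains p X) \<Longrightarrow> sum f A \<in> p_chains p X"
  by (induction A rule: infinite_finite_induct) (simp_all add: zero_in_p_chains add_in_p_chains)

lemma boundary_in_p_chains:
  assumes X: "simplicial_complex X" and c: "c \<in> p_chains (Suc p) X"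
  shows "boundary (Suc p) c \<in> p_chains p X"
proof -
  have single: "Poly_Mapping.single (\<sigma> - {v}) a \<in> p_chains p X"
    if \<sigma>: "\<sigma> \<in> Poly_Mapping.keys c" and v: "v \<in> \<sigma>" for \<sigma> v a
  proof -
    have \<sigma>': "\<sigma> \<in> X" "card \<sigma> = Suc (Suc p)"
      using c \<sigma> by (auto simp: p_chains_def)
    have card: "card (\<sigma> - {v}) = Suc p"
      using \<sigma>'(2) v by simp
    then have "\<sigma> - {v} \<noteq> {}"
      by (metis card.empty nat.distinct(1))
    moreover have "\<sigma> - {v} \<subseteq> \<sigma>"
      by (rule Diff_subset)
    ultimately have "\<sigma> - {v} \<in> X"
      using X \<sigma>'(1) unfolding simplicial_complex_def by metis
    with card show ?thesis
      by (simp add: p_chains_def)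
  qed
  show ?thesis
    unfolding boundary_def if_not_P[OF nat.distinct(2)]
    by (intro sum_in_p_chains single)
qed

lemma boundaries_subset_cycles:
  "simplicial_complex X \<Longrightarrow> boundaries p X \<subseteq> cycles p X"
  by (auto simp: boundaries_def cycles_def boundary_in_p_chains boundary_boundary)

lemma zero_in_cycles: "0 \<in> cycles p X"
  by (simp add: cycles_def zero_in_p_chains boundary_zero)

lemma add_in_cycles: "c \<in> cycles p X \<Longrightarrow> d \<in> cycles p X \<Longrightarrow> c + d \<in> cycles p X"
  by (simp add: cycles_def add_in_p_chains boundary_add)

lemma zero_in_boundaries: "0 \<in> boundaries p X"
  unfolding boundaries_def by (rule image_eqI[OF _ zero_in_p_chains]) (simp add: boundary_zero)

lemma add_in_boundaries:
  "c \<in> boundaries p X \<Longrightarrow> d \<in> boundaries p X \<Longrightarrow> c + d \<in> boundaries p X"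
  unfolding boundaries_def using add_in_p_chains by (fastforce simp flip: boundary_add)

lemma vectorspace_cycle_space: "vectorspace Z2 (cycle_space p X)"
  unfolding cycle_space_def
  by (intro vectorspace_chain_module zero_in_cycles add_in_cycles)

lemma vectorspace_boundary_space: "vectorspace Z2 (boundary_space p X)"
  unfolding boundary_space_def
  by (intro vectorspace_chain_module zero_in_boundaries add_in_boundaries)

lemma submodule_boundaries:
  assumes "simplicial_complex X"
  shows "submodule Z2 (boundaries p X) (cycle_space p X)"
proof (rule submodule.intro)
  show "Module.module Z2 (cycle_space p X)"
    using vectorspace_cycle_space by (rule vectorspace.axioms)
qed (use boundaries_subset_cycles[OF assms] in
      \<open>auto simp: cycle_space_def chain_module_def zero_in_boundaries add_in_boundaries
         chain_smult_cases\<close>)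

lemma submodule_abelian_subgroup:
  assumes "submodule F N M"
  shows "abelian_subgroup N M"
proof -
  interpret submodule F N M by fact
  interpret Module.module F M by (rule module)
  show ?thesis
  proof (rule abelian_subgroupI3)
    show "additive_subgroup N M"
    proof (rule additive_subgroup.intro, rule add.subgroupI)
      fix a assume a: "a \<in> N"
      then have "\<ominus>\<^bsub>M\<^esub> a = (\<ominus>\<^bsub>F\<^esub> \<one>\<^bsub>F\<^esub>) \<odot>\<^bsub>M\<^esub> a"
        using subset by (auto simp: smult_l_minus)
      with a show "\<ominus>\<^bsub>M\<^esub> a \<in> N"
        by simp
    next
      show "N \<noteq> {}"
        using submodule.zero_closed[OF assms] by blast
    qed (use subset in auto)
  qed unfold_locales
qed

lemma quotient_smult_coset:
  assumes "submodule F N M" "a \<in> carrier F" "x \<in> carrier M"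
  shows "a \<odot>\<^bsub>quotient_module M N\<^esub> (N +>\<^bsub>M\<^esub> x) = N +>\<^bsub>M\<^esub> (a \<odot>\<^bsub>M\<^esub> x)"
proof -
  interpret submodule F N M by fact
  interpret Module.module F M by (rule module)
  interpret abelian_subgroup N M by (rule submodule_abelian_subgroup) fact
  have sub: "x \<in> carrier M" if "x \<in> N" for x
    using subset that by auto
  have "a \<odot>\<^bsub>quotient_module M N\<^esub> (N +>\<^bsub>M\<^esub> x) =
      {h \<oplus>\<^bsub>M\<^esub> a \<odot>\<^bsub>M\<^esub> (k \<oplus>\<^bsub>M\<^esub> x) | h k. h \<in> N \<and> k \<in> N}"
    by (auto simp: quotient_module_def set_add_def' a_r_coset_def')
  also have "\<dots> = {h \<oplus>\<^bsub>M\<^esub> a \<odot>\<^bsub>M\<^esub> x | h. h \<in> N}" (is "?L = ?R")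
  proof
    show "?L \<subseteq> ?R"
    proof safe
      fix h k assume hk: "h \<in> N" "k \<in> N"
      then have "h \<oplus>\<^bsub>M\<^esub> a \<odot>\<^bsub>M\<^esub> (k \<oplus>\<^bsub>M\<^esub> x) = (h \<oplus>\<^bsub>M\<^esub> a \<odot>\<^bsub>M\<^esub> k) \<oplus>\<^bsub>M\<^esub> a \<odot>\<^bsub>M\<^esub> x"
        using assms sub by (simp add: smult_r_distr a_assoc)
      with hk assms show "\<exists>h'. h \<oplus>\<^bsub>M\<^esub> a \<odot>\<^bsub>M\<^esub> (k \<oplus>\<^bsub>M\<^esub> x) = h' \<oplus>\<^bsub>M\<^esub> a \<odot>\<^bsub>M\<^esub> x \<and> h' \<in> N"
        by (intro exI[of _ "h \<oplus>\<^bsub>M\<^esub> a \<odot>\<^bsub>M\<^esub> k"])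
           (simp add: submodule.m_closed[OF assms(1)] submodule.smult_closed[OF assms(1)])
    qed
    show "?R \<subseteq> ?L"
    proof safe
      fix h assume h: "h \<in> N"
      have "h \<oplus>\<^bsub>M\<^esub> a \<odot>\<^bsub>M\<^esub> x = h \<oplus>\<^bsub>M\<^esub> a \<odot>\<^bsub>M\<^esub> (\<zero>\<^bsub>M\<^esub> \<oplus>\<^bsub>M\<^esub> x)"
        using assms by simp
      with h show "\<exists>h' k. h \<oplus>\<^bsub>M\<^esub> a \<odot>\<^bsub>M\<^esub> x = h' \<oplus>\<^bsub>M\<^esub> a \<odot>\<^bsub>M\<^esub> (k \<oplus>\<^bsub>M\<^esub> x) \<and> h' \<in> N \<and> k \<in> N"
        using submodule.zero_closed[OF assms(1)] by blast
    qed
  qed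
  also have "\<dots> = N +>\<^bsub>M\<^esub> (a \<odot>\<^bsub>M\<^esub> x)"
    by (auto simp: a_r_coset_def')
  finally show ?thesis .
qed

lemma vectorspace_quotient_module:
  assumes V: "vectorspace F M" and N: "submodule F N M"
  shows "vectorspace F (quotient_module M N)"
proof -
  let ?Q = "quotient_module M N"
  interpret vectorspace F M by fact
  interpret submodule F N M by fact
  interpret abelian_subgroup N M by (rule submodule_abelian_subgroup) fact
  have car: "carrier ?Q = (\<lambda>x. N +>\<^bsub>M\<^esub> x) ` carrier M"
    by (auto simp: quotient_module_def A_RCOSETS_def')
  have add: "(N +>\<^bsub>M\<^esub> x) \<oplus>\<^bsub>?Q\<^esub> (N +>\<^bsub>M\<^esub> y) = N +>\<^bsub>M\<^esub> (x \<oplus>\<^bsub>M\<^esub> y)"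
    if "x \<in> carrier M" "y \<in> carrier M" for x y
    using that by (simp add: quotient_module_def a_rcos_sum)
  have zero: "\<zero>\<^bsub>?Q\<^esub> = N +>\<^bsub>M\<^esub> \<zero>\<^bsub>M\<^esub>"
    by (simp add: quotient_module_def a_coset_add_zero subset)
  note smult = quotient_smult_coset[OF N]
  show ?thesis
  proof (rule vs_criteria)
    show "field F" by unfold_locales
    show "\<forall>v\<in>carrier ?Q. \<exists>neg_v\<in>carrier ?Q. v \<oplus>\<^bsub>?Q\<^esub> neg_v = \<zero>\<^bsub>?Q\<^esub>"
      unfolding car
    proof safe
      fix x assume x: "x \<in> carrier M"
      then show "\<exists>neg_v\<in>(\<lambda>x. N +>\<^bsub>M\<^esub> x) ` carrier M. (N +>\<^bsub>M\<^esub> x) \<oplus>\<^bsub>?Q\<^esub> neg_v = \<zero>\<^bsub>?Q\<^esub>"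
        by (intro bexI[of _ "N +>\<^bsub>M\<^esub> (\<ominus>\<^bsub>M\<^esub> x)"]) (simp_all add: add zero M.r_neg)
    qed
  qed (auto simp: car add zero smult M.a_ac smult_assoc1 smult_l_distr smult_r_distr)
qed

lemma vectorspace_homology:
  "simplicial_complex X \<Longrightarrow> vectorspace Z2 (homology p X)"
  unfolding homology_def
  by (intro vectorspace_quotient_module vectorspace_cycle_space submodule_boundaries)

lemma hclass_eq: "hclass p X \<alpha> = {b + \<alpha> | b. b \<in> boundaries p X}"
  by (auto simp: hclass_def a_r_coset_def' cycle_space_def chain_module_def)

lemma boundaries_mono: "X \<subseteq> Y \<Longrightarrow> boundaries p X \<subseteq> boundaries p Y"
  by (auto simp: boundaries_def p_chains_def)

lemma hclass_cong:
  assumes "b \<in> boundaries p Y"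
  shows "hclass p Y (b + \<alpha>) = hclass p Y \<alpha>"
proof -
  have "\<exists>b'. c + \<alpha> = b' + (b + \<alpha>) \<and> b' \<in> boundaries p Y" if "c \<in> boundaries p Y" for c
    by (rule exI[of _ "c + b"])
       (use that assms in \<open>simp add: add_in_boundaries add.assoc chain_add_self
          flip: add.assoc[of b b]\<close>)
  moreover have "\<exists>b'. c + (b + \<alpha>) = b' + \<alpha> \<and> b' \<in> boundaries p Y"
    if "c \<in> boundaries p Y" for c
    by (rule exI[of _ "c + b"]) (use that assms in \<open>simp add: add_in_boundaries add.assoc\<close>)
  ultimately show ?thesis
    unfolding hclass_eq by blast
qed

lemma induced_hclass:
  assumes "X \<subseteq> Y"
  shows "induced p X Y (hclass p X \<alpha>) = hclass p Y \<alpha>"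
proof -
  have "hclass p Y c = hclass p Y \<alpha>" if c: "c \<in> hclass p X \<alpha>" for c
  proof -
    obtain b where "c = b + \<alpha>" "b \<in> boundaries p X"
      using c by (auto simp: hclass_eq)
    with boundaries_mono[OF assms] show ?thesis
      using hclass_cong by blast
  qed
  moreover have "0 + \<alpha> \<in> hclass p X \<alpha>"
    using zero_in_boundaries unfolding hclass_eq by blast
  ultimately have "hclass p Y ` hclass p X \<alpha> = {hclass p Y \<alpha>}"
    by (metis empty_iff image_cong image_constant_conv)
  then show ?thesis
    by (simp add: induced_def)
qed

end

theory Submission
  imports Defs
begin

text \<open>
  Over the field with two elements a linear combination of a finite set \<open>A\<close> is the sum of a
  subset of \<open>A\<close>, so \<open>A\<close> is a basis exactly when every vector is the sum of a unique subset
  (\<open>basis_Z2_iff\<close>). All arguments below compare such subsets.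

  Fix \<open>i\<close>. The elements of a barcode basis born at \<open>i\<close> form a basis \<open>E\<close> of the cycles, those dead
  at \<open>i\<close> a basis \<open>D\<close> of the boundaries, and \<open>D \<subseteq> E\<close> because a boundary is a cycle from that
  index on (\<open>dead_subset_born\<close>). The alive elements are \<open>E - D\<close>, and the classes of a basis
  of a space minus a basis of a subspace form a basis of the quotient (\<open>homology_basis\<close>).

  Let \<open>\<alpha>\<close> be a cycle of \<open>L i\<close>, hence of \<open>K i\<close>. It is the sum of a subset of the elements of
  \<open>A_K\<close> born at \<open>i\<close>. This subset also represents \<open>\<alpha>\<close> in the basis \<open>A_K\<close> of all cycles of \<open>K n\<close>,
  so by uniqueness it is the set of neighbours of \<open>\<alpha>\<close> in the graphcode
  (\<open>neighbours_born_sum\<close>): every neighbour is born at \<open>i\<close>. Passing to classes in \<open>K i\<close>,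
  the dead neighbours contribute zero and the alive ones remain
  (\<open>hclass_eq_sum_alive_neighbours\<close>). A linear map is determined by its values on a basis, so
  these formulas determine the induced map (\<open>linear_maps_agree\<close>).
\<close>

section \<open>Bases over the field with two elements\<close>

lemma lincomb_Z2:
  assumes "vectorspace Z2 V" "finite A" "A \<subseteq> carrier V"
  shows "module.lincomb V a A = (\<Oplus>\<^bsub>V\<^esub>x\<in>{x \<in> A. a x = 1}. x)"
proof -
  interpret vectorspace Z2 V by fact
  have one: "(1::bit) \<odot>\<^bsub>V\<^esub> x = x" if "x \<in> carrier V" for x
    using smult_one[OF that] by simp
  have zero: "(0::bit) \<odot>\<^bsub>V\<^esub> x = \<zero>\<^bsub>V\<^esub>" if "x \<in> carrier V" for x
    using smult_l_null[OF that] by simp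
  show ?thesis
    unfolding lincomb_def
  proof (rule M.add.finprod_mono_neutral_cong_right)
    fix x assume "x \<in> A - {x \<in> A. a x = 1}"
    then have "x \<in> carrier V" "a x = 0"
      using assms(3) bit.exhaust by auto
    then show "a x \<odot>\<^bsub>V\<^esub> x = \<zero>\<^bsub>V\<^esub>"
      by (simp add: zero)
  next
    show "(\<lambda>x. a x \<odot>\<^bsub>V\<^esub> x) \<in> A \<rightarrow> carrier V"
      using assms(3) by (auto intro!: smult_closed)
  qed (use assms one in auto)
qed

lemma ex1_bij_betw:
  assumes "bij_betw f A {y. P y}"
  shows "(\<exists>!x. x \<in> A \<and> Q (f x)) \<longleftrightarrow> (\<exists>!y. P y \<and> Q y)"
proof
  assume "\<exists>!x. x \<in> A \<and> Q (f x)"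
  then obtain x where x: "x \<in> A" "Q (f x)" "\<And>x'. x' \<in> A \<Longrightarrow> Q (f x') \<Longrightarrow> x' = x"
    by blast
  show "\<exists>!y. P y \<and> Q y"
  proof (rule ex1I[of _ "f x"])
    show "P (f x) \<and> Q (f x)"
      using assms x(1,2) by (auto simp: bij_betw_def)
  next
    fix y assume "P y \<and> Q y"
    moreover from this obtain x' where "x' \<in> A" "y = f x'"
      using assms by (metis bij_betw_imp_surj_on imageE mem_Collect_eq)
    ultimately show "y = f x"
      using x(3) by blast
  qed
next
  assume "\<exists>!y. P y \<and> Q y"
  then obtain y where y: "P y" "Q y" "\<And>y'. P y' \<Longrightarrow> Q y' \<Longrightarrow> y' = y"
    by blast
  obtain x where x: "x \<in> A" "f x = y"
    using assms y(1) by (metis bij_betw_imp_surj_on imageE mem_Collect_eq)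
  show "\<exists>!x. x \<in> A \<and> Q (f x)"
  proof (rule ex1I[of _ x])
    fix x' assume x': "x' \<in> A \<and> Q (f x')"
    moreover have "P (f x')"
      using assms x' by (auto simp: bij_betw_def)
    ultimately have "f x' = f x"
      using x(2) y(3) by blast
    then show "x' = x"
      using assms x x' by (auto simp: bij_betw_def inj_on_def)
  qed (use x y(2) in simp)
qed

text \<open>A coefficient function on \<open>A\<close> with values 0 and 1 is the indicator of a subset of \<open>A\<close>.\<close>

lemma basis_Z2_iff:
  assumes "vectorspace Z2 V" "finite A" "A \<subseteq> carrier V"
  shows "vectorspace.basis Z2 V A \<longleftrightarrow>
    (\<forall>v\<in>carrier V. \<exists>!S. S \<subseteq> A \<and> (\<Oplus>\<^bsub>V\<^esub>x\<in>S. x) = v)"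
proof -
  interpret vectorspace Z2 V by fact
  have bij: "bij_betw (\<lambda>a. {x \<in> A. a x = (1::bit)}) (A \<rightarrow>\<^sub>E UNIV) (Pow A)"
  proof (rule bij_betwI[where g = "\<lambda>S. \<lambda>x\<in>A. if x \<in> S then 1 else 0"])
    fix a :: "_ \<Rightarrow> bit" assume a: "a \<in> A \<rightarrow>\<^sub>E UNIV"
    show "(\<lambda>x\<in>A. if x \<in> {x \<in> A. a x = 1} then 1 else 0) = a"
    proof
      fix x
      show "(\<lambda>x\<in>A. if x \<in> {x \<in> A. a x = 1} then 1 else 0) x = a x"
        using a bit.exhaust[of "a x"] by (auto simp: PiE_def extensional_def)
    qed
  qed auto
  have "(\<exists>!a. a \<in> A \<rightarrow>\<^sub>E carrier Z2 \<and> lincomb a A = v) \<longleftrightarrow>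
        (\<exists>!S. S \<subseteq> A \<and> (\<Oplus>\<^bsub>V\<^esub>x\<in>S. x) = v)" for v
    unfolding lincomb_Z2[OF assms] using bij
    by (intro ex1_bij_betw) (simp add: Pow_def)
  then show ?thesis
    using basis_criterion[OF assms(2,3)] by (simp add: Ball_def)
qed

lemma basis_subset_carrier:
  assumes "vectorspace F V" "vectorspace.basis F V A"
  shows "A \<subseteq> carrier V"
  using assms(2) unfolding vectorspace.basis_def[OF assms(1)] by blast

text \<open>
  The coordinates are defined by a definite description; here uniqueness of coefficients
  identifies them with the indicator of \<open>S\<close>.
\<close>

lemma coordinate_eq_1_iff:
  assumes V: "vectorspace Z2 V" and A: "finite A" "vectorspace.basis Z2 V A"
    and S: "S \<subseteq> A" "(\<Oplus>\<^bsub>V\<^esub>x\<in>S. x) \<in> carrier V" and x: "x \<in> A"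
  shows "coordinate Z2 V A (\<Oplus>\<^bsub>V\<^esub>x\<in>S. x) x = 1 \<longleftrightarrow> x \<in> S"
proof -
  interpret vectorspace Z2 V by fact
  have AC: "A \<subseteq> carrier V"
    using basis_subset_carrier[OF V A(2)] .
  let ?P = "\<lambda>a. a \<in> A \<rightarrow>\<^sub>E carrier Z2 \<and> lincomb a A = (\<Oplus>\<^bsub>V\<^esub>x\<in>S. x)"
  let ?a = "\<lambda>x\<in>A. if x \<in> S then 1 else 0 :: bit"
  have "{x \<in> A. ?a x = 1} = S"
    using S(1) by auto
  then have "?P ?a"
    by (simp add: lincomb_Z2[OF V A(1) AC] del: restrict_apply)
  moreover have "\<exists>!a. ?P a"
    using basis_criterion[OF A(1) AC] A(2) S(2) by blast
  ultimately have "(THE a. ?P a) = ?a"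
    by (rule the1_equality[rotated])
  then show ?thesis
    unfolding coordinate_def using x by simp
qed

lemma linear_maps_agree:
  assumes f: "linear_map Z2 V W f" and g: "linear_map Z2 V W g"
    and A: "finite A" "vectorspace.basis Z2 V A"
    and eq: "\<And>a. a \<in> A \<Longrightarrow> f a = g a" and v: "v \<in> carrier V"
  shows "f v = g v"
proof -
  interpret f: linear_map Z2 V W f by fact
  interpret g: linear_map Z2 V W g by fact
  have AC: "A \<subseteq> carrier V"
    using basis_subset_carrier[OF f.V.vectorspace_axioms A(2)] .
  obtain S where S: "S \<subseteq> A" "(\<Oplus>\<^bsub>V\<^esub>x\<in>S. x) = v"
    using basis_Z2_iff[OF f.V.vectorspace_axioms A(1) AC] A(2) v by blast
  have SC: "S \<subseteq> carrier V"
    using S(1) AC by blast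
  have "f v = (\<Oplus>\<^bsub>W\<^esub>x\<in>S. f x)"
    unfolding S(2)[symmetric] using SC by (intro f.hom_sum) auto
  also have "\<dots> = (\<Oplus>\<^bsub>W\<^esub>x\<in>S. g x)"
    using S(1) SC eq by (intro f.W.module.M.finsum_cong') auto
  also have "\<dots> = g v"
    unfolding S(2)[symmetric] using SC by (intro g.hom_sum[symmetric]) auto
  finally show ?thesis .
qed

section \<open>Bases of cycles and boundaries\<close>

lemma carrier_chain_module: "carrier (chain_module C) = C"
  by (simp add: chain_module_def)

lemma carrier_cycle_space: "carrier (cycle_space p X) = cycles p X"
  by (simp add: cycle_space_def carrier_chain_module)

lemma carrier_boundary_space: "carrier (boundary_space p X) = boundaries p X"
  by (simp add: boundary_space_def carrier_chain_module)

text \<open>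
  Addition is the same in every chain module, so sums can be taken in the type of chains. This
  makes it possible to compare expansions in the cycle spaces of different complexes.
\<close>

lemma finsum_chain_module:
  assumes C: "vectorspace Z2 (chain_module C)" and S: "S \<subseteq> C"
  shows "(\<Oplus>\<^bsub>chain_module C\<^esub>x\<in>S. x) = (\<Sum>x\<in>S. x)"
proof -
  interpret vectorspace Z2 "chain_module C" by fact
  show ?thesis
    using S
  proof (induction S rule: infinite_finite_induct)
    case (infinite S)
    then show ?case by simp (simp add: chain_module_def)
  next
    case empty
    then show ?case by simp (simp add: chain_module_def)
  next
    case (insert x S)
    then have "(\<Oplus>\<^bsub>chain_module C\<^esub>x\<in>insert x S. x) =
        x \<oplus>\<^bsub>chain_module C\<^esub> (\<Oplus>\<^bsub>chain_module C\<^esub>x\<in>S. x)"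
      by (intro M.finsum_insert) (auto simp: chain_module_def)
    with insert show ?case
      by (simp add: chain_module_def)
  qed
qed

lemma basis_chain_moduleD:
  assumes C: "vectorspace Z2 (chain_module C)"
    and A: "finite A" "vectorspace.basis Z2 (chain_module C) A"
  shows "A \<subseteq> C" and "v \<in> C \<Longrightarrow> \<exists>!S. S \<subseteq> A \<and> (\<Sum>x\<in>S. x) = v"
    and "S \<subseteq> A \<Longrightarrow> (\<Sum>x\<in>S. x) \<in> C"
proof -
  interpret vectorspace Z2 "chain_module C" by fact
  show AC: "A \<subseteq> C"
    using basis_subset_carrier[OF C A(2)] by (simp add: carrier_chain_module)
  then have car: "A \<subseteq> carrier (chain_module C)"
    by (simp add: chain_module_def)
  have sum: "(\<Oplus>\<^bsub>chain_module C\<^esub>x\<in>S. x) = (\<Sum>x\<in>S. x)" if "S \<subseteq> A" for S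
    using finsum_chain_module[OF C] that AC by blast
  show "\<exists>!S. S \<subseteq> A \<and> (\<Sum>x\<in>S. x) = v" if v: "v \<in> C"
  proof -
    have "\<exists>!S. S \<subseteq> A \<and> (\<Oplus>\<^bsub>chain_module C\<^esub>x\<in>S. x) = v"
      using basis_Z2_iff[OF C A(1) car] A(2) v by (simp add: chain_module_def)
    then show ?thesis
      using sum by metis
  qed
  show "(\<Sum>x\<in>S. x) \<in> C" if "S \<subseteq> A"
  proof -
    have "(\<Oplus>\<^bsub>chain_module C\<^esub>x\<in>S. x) \<in> carrier (chain_module C)"
      using that car by (intro M.finsum_closed) auto
    then show ?thesis
      using sum[OF that] by (simp add: chain_module_def)
  qed
qed

text \<open>A chain modulo 2 is determined by its support.\<close>

lemma finite_cycles:
  assumes "finite X"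
  shows "finite (cycles p X)"
proof (rule finite_imageD)
  have "Poly_Mapping.keys ` cycles p X \<subseteq> Pow X"
    by (auto simp: cycles_def p_chains_def)
  then show "finite (Poly_Mapping.keys ` cycles p X)"
    using assms by (metis finite_Pow_iff finite_subset)
  show "inj_on Poly_Mapping.keys (cycles p X)"
  proof
    fix c d :: "'a chain" assume "Poly_Mapping.keys c = Poly_Mapping.keys d"
    then have keys: "Poly_Mapping.lookup c \<sigma> = 0 \<longleftrightarrow> Poly_Mapping.lookup d \<sigma> = 0" for \<sigma>
      by (metis in_keys_iff)
    show "c = d"
    proof (rule poly_mapping_eqI)
      fix \<sigma>
      show "Poly_Mapping.lookup c \<sigma> = Poly_Mapping.lookup d \<sigma>"
        using keys[of \<sigma>] by (cases "Poly_Mapping.lookup c \<sigma>"; cases "Poly_Mapping.lookup d \<sigma>") simp_all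
    qed
  qed
qed

lemmas basis_cycle_spaceD =
  basis_chain_moduleD[OF vectorspace_cycle_space[unfolded cycle_space_def],
    folded cycle_space_def]

lemmas basis_boundary_spaceD =
  basis_chain_moduleD[OF vectorspace_boundary_space[unfolded boundary_space_def],
    folded boundary_space_def]

section \<open>Homology classes\<close>

text \<open>The sum plays the role of the difference, since \<open>- \<beta> = \<beta>\<close> modulo 2.\<close>

lemma hclass_eq_iff: "hclass p X \<alpha> = hclass p X \<beta> \<longleftrightarrow> \<alpha> + \<beta> \<in> boundaries p X"
proof
  assume "hclass p X \<alpha> = hclass p X \<beta>"
  moreover have "\<alpha> \<in> hclass p X \<alpha>"
    using zero_in_boundaries[of p X] by (force simp: hclass_eq)
  ultimately obtain b where "\<alpha> = b + \<beta>" "b \<in> boundaries p X"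
    by (auto simp: hclass_eq)
  then show "\<alpha> + \<beta> \<in> boundaries p X"
    by (simp add: add.assoc chain_add_self)
next
  assume "\<alpha> + \<beta> \<in> boundaries p X"
  then have "hclass p X ((\<alpha> + \<beta>) + \<beta>) = hclass p X \<beta>"
    by (rule hclass_cong)
  then show "hclass p X \<alpha> = hclass p X \<beta>"
    by (simp add: add.assoc chain_add_self)
qed

lemma carrier_homology: "carrier (homology p X) = hclass p X ` cycles p X"
  by (auto simp: homology_def quotient_module_def A_RCOSETS_def' hclass_def cycle_space_def
      chain_module_def)

lemma linear_map_hclass:
  assumes X: "simplicial_complex X"
  shows "linear_map Z2 (cycle_space p X) (homology p X) (hclass p X)"
proof -
  interpret V: vectorspace Z2 "cycle_space p X" by (rule vectorspace_cycle_space)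
  interpret W: vectorspace Z2 "homology p X" by (rule vectorspace_homology) fact
  note N = submodule_boundaries[OF X, of p]
  interpret N: abelian_subgroup "boundaries p X" "cycle_space p X"
    by (rule submodule_abelian_subgroup) (rule N)
  have "hclass p X \<in> LinearCombinations.module_hom Z2 (cycle_space p X) (homology p X)"
    unfolding LinearCombinations.module_hom_def
  proof (intro CollectI conjI allI impI)
    show "hclass p X \<in> carrier (cycle_space p X) \<rightarrow> carrier (homology p X)"
      by (auto simp: carrier_homology) (simp add: cycle_space_def chain_module_def)
    show "hclass p X (c \<oplus>\<^bsub>cycle_space p X\<^esub> d) =
        hclass p X c \<oplus>\<^bsub>homology p X\<^esub> hclass p X d"
      if "c \<in> carrier (cycle_space p X) \<and> d \<in> carrier (cycle_space p X)" for c d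
      using that by (simp add: hclass_def homology_def quotient_module_def N.a_rcos_sum)
    show "hclass p X (r \<odot>\<^bsub>cycle_space p X\<^esub> c) = r \<odot>\<^bsub>homology p X\<^esub> hclass p X c"
      if "r \<in> carrier Z2 \<and> c \<in> carrier (cycle_space p X)" for r c
      using that quotient_smult_coset[OF N] by (simp add: hclass_def homology_def)
  qed
  then show ?thesis
    by (intro linear_map.intro mod_hom.intro mod_hom_axioms.intro V.vectorspace_axioms
        W.vectorspace_axioms V.module_axioms W.module_axioms)
qed

lemma hclass_sum:
  assumes X: "simplicial_complex X" and S: "S \<subseteq> cycles p X"
  shows "hclass p X (\<Sum>\<alpha>\<in>S. \<alpha>) = (\<Oplus>\<^bsub>homology p X\<^esub>\<alpha>\<in>S. hclass p X \<alpha>)"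
proof -
  interpret linear_map Z2 "cycle_space p X" "homology p X" "hclass p X"
    by (rule linear_map_hclass) fact
  have S': "S \<subseteq> carrier (cycle_space p X)"
    using S by (simp add: cycle_space_def chain_module_def)
  have "(\<Oplus>\<^bsub>cycle_space p X\<^esub>\<alpha>\<in>S. \<alpha>) = (\<Sum>\<alpha>\<in>S. \<alpha>)"
    using finsum_chain_module S vectorspace_cycle_space unfolding cycle_space_def by blast
  then show ?thesis
    using hom_sum[of S "\<lambda>\<alpha>. \<alpha>"] S' by auto
qed

lemma sum_in_boundaries: "S \<subseteq> boundaries p X \<Longrightarrow> (\<Sum>\<alpha>\<in>S. \<alpha>) \<in> boundaries p X"
  by (induction S rule: infinite_finite_induct) (auto simp: zero_in_boundaries add_in_boundaries)

lemma hclass_sum_drop_boundaries: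
  assumes "finite S" "D \<subseteq> boundaries p X"
  shows "hclass p X (\<Sum>\<alpha>\<in>S. \<alpha>) = hclass p X (\<Sum>\<alpha>\<in>S - D. \<alpha>)"
proof -
  have "(\<Sum>\<alpha>\<in>S. \<alpha>) = (\<Sum>\<alpha>\<in>S \<inter> D. \<alpha>) + (\<Sum>\<alpha>\<in>S - D. \<alpha>)"
    using assms(1) by (rule sum.Int_Diff)
  moreover have "(\<Sum>\<alpha>\<in>S \<inter> D. \<alpha>) \<in> boundaries p X"
    using assms(2) by (intro sum_in_boundaries) blast
  ultimately show ?thesis
    by (simp add: hclass_cong)
qed

text \<open>
  Removing the elements of \<open>D\<close> from an expansion in \<open>E\<close> does not change the class, so the
  remaining classes span. If two subsets of \<open>E - D\<close> have homologous sums, their difference expands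
  in \<open>D\<close>; uniqueness of expansions in \<open>E\<close> forces this expansion to be empty and the
  subsets to be equal. For singletons this gives injectivity of the class map on \<open>E - D\<close>, for
  arbitrary subsets linear independence of the image.
\<close>

lemma homology_basis:
  assumes X: "simplicial_complex X"
    and E: "finite E" "vectorspace.basis Z2 (cycle_space p X) E"
    and D: "D \<subseteq> E" "vectorspace.basis Z2 (boundary_space p X) D"
  shows "inj_on (hclass p X) (E - D)"
    and "vectorspace.basis Z2 (homology p X) (hclass p X ` (E - D))"
proof -
  interpret H: vectorspace Z2 "homology p X" by (rule vectorspace_homology) fact
  have finD: "finite D"
    using D(1) E(1) by (rule finite_subset)
  note Z = basis_cycle_spaceD[OF E]
  note B = basis_boundary_spaceD[OF finD D(2)]
  have inj: "S = T" if ST: "S \<subseteq> E - D" "T \<subseteq> E - D"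
    and eq: "hclass p X (\<Sum>\<alpha>\<in>S. \<alpha>) = hclass p X (\<Sum>\<alpha>\<in>T. \<alpha>)" for S T
  proof -
    have fin: "finite T"
      using ST(2) E(1) by (meson finite_Diff finite_subset)
    have "(\<Sum>\<alpha>\<in>S. \<alpha>) + (\<Sum>\<alpha>\<in>T. \<alpha>) \<in> boundaries p X"
      using eq by (simp add: hclass_eq_iff)
    then obtain U where U: "U \<subseteq> D" "(\<Sum>\<alpha>\<in>U. \<alpha>) = (\<Sum>\<alpha>\<in>S. \<alpha>) + (\<Sum>\<alpha>\<in>T. \<alpha>)"
      using B(2) by blast
    \<comment> \<open>The sum over \<open>T \<union> U\<close> is that over \<open>S\<close>, as the two copies of the sum over \<open>T\<close> cancel.\<close>
    have "(\<Sum>\<alpha>\<in>T \<union> U. \<alpha>) = (\<Sum>\<alpha>\<in>T. \<alpha>) + (\<Sum>\<alpha>\<in>U. \<alpha>)"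
      using fin finite_subset[OF U(1) finD] ST(2) U(1) by (intro sum.union_disjoint) auto
    also have "\<dots> = (\<Sum>\<alpha>\<in>S. \<alpha>) + ((\<Sum>\<alpha>\<in>T. \<alpha>) + (\<Sum>\<alpha>\<in>T. \<alpha>))"
      by (simp only: U(2) ac_simps)
    finally have "(\<Sum>\<alpha>\<in>T \<union> U. \<alpha>) = (\<Sum>\<alpha>\<in>S. \<alpha>)"
      by (simp add: chain_add_self)
    moreover have "T \<union> U \<subseteq> E" "S \<subseteq> E"
      using ST U(1) D(1) by auto
    ultimately have "T \<union> U = S"
      using Z(2)[OF Z(3)[of S]] by blast
    then show ?thesis
      using ST U(1) by auto
  qed
  show inj_on: "inj_on (hclass p X) (E - D)"
  proof
    fix \<alpha> \<beta> assume "\<alpha> \<in> E - D" "\<beta> \<in> E - D" "hclass p X \<alpha> = hclass p X \<beta>"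
    then show "\<alpha> = \<beta>"
      using inj[of "{\<alpha>}" "{\<beta>}"] by simp
  qed
  have finsum: "(\<Oplus>\<^bsub>homology p X\<^esub>x\<in>hclass p X ` S. x) = hclass p X (\<Sum>\<alpha>\<in>S. \<alpha>)"
    if "S \<subseteq> E - D" for S
  proof -
    have SC: "S \<subseteq> cycles p X"
      using that Z(1) by auto
    then have "(\<Oplus>\<^bsub>homology p X\<^esub>x\<in>hclass p X ` S. x) = (\<Oplus>\<^bsub>homology p X\<^esub>\<alpha>\<in>S. hclass p X \<alpha>)"
      using that by (intro H.M.finsum_reindex inj_on_subset[OF inj_on]) (auto simp: carrier_homology)
    then show ?thesis
      using hclass_sum[OF X SC] by simp
  qed
  have "\<exists>!T. T \<subseteq> hclass p X ` (E - D) \<and> (\<Oplus>\<^bsub>homology p X\<^esub>x\<in>T. x) = v"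
    if v: "v \<in> carrier (homology p X)" for v
  proof -
    obtain S where S: "S \<subseteq> E" "v = hclass p X (\<Sum>\<alpha>\<in>S. \<alpha>)"
      using v Z(2) by (auto simp: carrier_homology) metis
    then have v': "v = hclass p X (\<Sum>\<alpha>\<in>S - D. \<alpha>)"
      using hclass_sum_drop_boundaries[OF finite_subset[OF S(1) E(1)] B(1)] by simp
    show ?thesis
    proof (rule ex1I[of _ "hclass p X ` (S - D)"])
      show "hclass p X ` (S - D) \<subseteq> hclass p X ` (E - D) \<and>
          (\<Oplus>\<^bsub>homology p X\<^esub>x\<in>hclass p X ` (S - D). x) = v"
        using S(1) finsum[of "S - D"] v' by auto
    next
      fix T assume T: "T \<subseteq> hclass p X ` (E - D) \<and> (\<Oplus>\<^bsub>homology p X\<^esub>x\<in>T. x) = v"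
      then obtain R where R: "R \<subseteq> E - D" "T = hclass p X ` R"
        by (meson subset_imageE)
      have "hclass p X (\<Sum>\<alpha>\<in>R. \<alpha>) = hclass p X (\<Sum>\<alpha>\<in>S - D. \<alpha>)"
        using T finsum[OF R(1)] v' unfolding R(2) by metis
      moreover have "S - D \<subseteq> E - D"
        using S(1) by blast
      ultimately have "R = S - D"
        using inj[OF R(1)] by blast
      with R(2) show "T = hclass p X ` (S - D)"
        by simp
    qed
  qed
  then show "vectorspace.basis Z2 (homology p X) (hclass p X ` (E - D))"
    using E(1) Z(1)
    by (subst basis_Z2_iff[OF H.vectorspace_axioms]) (auto simp: carrier_homology)
qed

lemma cycles_mono: "X \<subseteq> Y \<Longrightarrow> cycles p X \<subseteq> cycles p Y"
  by (auto simp: cycles_def p_chains_def)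

text \<open>
  Linearity holds because, on classes of cycles, the induced map only changes the subspace by
  which the same cycle is taken modulo.
\<close>

lemma linear_map_induced:
  assumes XY: "X \<subseteq> Y" and X: "simplicial_complex X" and Y: "simplicial_complex Y"
  shows "linear_map Z2 (homology p X) (homology p Y) (induced p X Y)"
proof -
  interpret X: linear_map Z2 "cycle_space p X" "homology p X" "hclass p X"
    by (rule linear_map_hclass) fact
  interpret Y: linear_map Z2 "cycle_space p Y" "homology p Y" "hclass p Y"
    by (rule linear_map_hclass) fact
  have add: "x \<oplus>\<^bsub>cycle_space p X\<^esub> y = x \<oplus>\<^bsub>cycle_space p Y\<^esub> y" for x y
    by (simp add: cycle_space_def chain_module_def)
  have smult: "r \<odot>\<^bsub>cycle_space p X\<^esub> x = r \<odot>\<^bsub>cycle_space p Y\<^esub> x" for r x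
    by (simp add: cycle_space_def chain_module_def)
  have sub: "x \<in> cycles p Y" if "x \<in> cycles p X" for x
    using cycles_mono[OF XY] that by blast
  have "induced p X Y \<in> LinearCombinations.module_hom Z2 (homology p X) (homology p Y)"
    unfolding LinearCombinations.module_hom_def
  proof (intro CollectI conjI allI impI)
    show "induced p X Y \<in> carrier (homology p X) \<rightarrow> carrier (homology p Y)"
      by (auto simp: carrier_homology induced_hclass[OF XY] sub)
  next
    fix v w assume "v \<in> carrier (homology p X) \<and> w \<in> carrier (homology p X)"
    then obtain c d where cd: "c \<in> cycles p X" "d \<in> cycles p X"
      and [simp]: "v = hclass p X c" "w = hclass p X d"
      by (auto simp: carrier_homology)
    have "v \<oplus>\<^bsub>homology p X\<^esub> w = hclass p X (c \<oplus>\<^bsub>cycle_space p X\<^esub> d)"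
      using cd by (simp add: carrier_cycle_space)
    then show "induced p X Y (v \<oplus>\<^bsub>homology p X\<^esub> w) =
        induced p X Y v \<oplus>\<^bsub>homology p Y\<^esub> induced p X Y w"
      using cd sub by (simp add: induced_hclass[OF XY] add carrier_cycle_space)
  next
    fix r v assume rv: "r \<in> carrier Z2 \<and> v \<in> carrier (homology p X)"
    then obtain c where c: "c \<in> cycles p X" and [simp]: "v = hclass p X c"
      by (auto simp: carrier_homology)
    have "r \<odot>\<^bsub>homology p X\<^esub> v = hclass p X (r \<odot>\<^bsub>cycle_space p X\<^esub> c)"
      using c rv by (simp add: carrier_cycle_space)
    then show "induced p X Y (r \<odot>\<^bsub>homology p X\<^esub> v) = r \<odot>\<^bsub>homology p Y\<^esub> induced p X Y v"
      using c rv sub by (simp add: induced_hclass[OF XY] smult carrier_cycle_space)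
  qed
  then show ?thesis
    by (intro linear_map.intro mod_hom.intro mod_hom_axioms.intro X.W.vectorspace_axioms
        Y.W.vectorspace_axioms vectorspace.axioms(1))
qed

section \<open>Barcode bases\<close>

lemma filtration_mono:
  assumes F: "filtration n X" and ij: "1 \<le> i" "i \<le> j" "j \<le> n"
  shows "X i \<subseteq> X j"
  using ij(2,3)
proof (induction j rule: dec_induct)
  case (step j)
  then have "X j \<subseteq> X (Suc j)"
    using F ij(1) by (auto simp: filtration_def)
  with step show ?case by simp
qed simp

text \<open>
  The death index is a \<open>LEAST\<close> and by itself says little about membership in the boundaries of
  \<open>X i\<close>; that membership comes from the basis condition at \<open>i\<close>.
\<close>

lemma dead_subset_born:
  assumes F: "filtration n X" and A: "barcode_basis p n X A" and i: "i \<in> {1..n}"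
  shows "{\<alpha> \<in> A. dead p n X \<alpha> i} \<subseteq> {\<alpha> \<in> A. already_born p n X \<alpha> i}"
proof
  fix \<alpha> assume \<alpha>: "\<alpha> \<in> {\<alpha> \<in> A. dead p n X \<alpha> i}"
  have "{\<alpha> \<in> A. dead p n X \<alpha> i} \<subseteq> boundaries p (X i)"
    using A i basis_subset_carrier[OF vectorspace_boundary_space]
    unfolding barcode_basis_def carrier_boundary_space[symmetric] by blast
  also have "\<dots> \<subseteq> cycles p (X i)"
    using F i by (intro boundaries_subset_cycles) (simp add: filtration_def)
  finally have "\<alpha> \<in> cycles p (X i)"
    using \<alpha> by blast
  then have "\<alpha> \<in> cycles p (X l)" if "l \<in> {i..n}" for l
    using cycles_mono[OF filtration_mono[OF F]] i that by fastforce
  then have "birth p n X \<alpha> \<le> i"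
    unfolding birth_def using i by (intro Least_le) blast
  with \<alpha> show "\<alpha> \<in> {\<alpha> \<in> A. already_born p n X \<alpha> i}"
    by (simp add: already_born_def)
qed

lemma alive_eq_born_minus_dead:
  "{\<alpha> \<in> A. alive p n X \<alpha> i} =
     {\<alpha> \<in> A. already_born p n X \<alpha> i} - {\<alpha> \<in> A. dead p n X \<alpha> i}"
  by (auto simp: alive_def dead_def)

lemma finite_barcode_basis:
  assumes F: "filtration n X" and A: "barcode_basis p n X A"
  shows "finite A"
proof (rule finite_subset)
  show "A \<subseteq> cycles p (X n)"
    using A basis_subset_carrier[OF vectorspace_cycle_space]
    by (auto simp: barcode_basis_def carrier_cycle_space)
  show "finite (cycles p (X n))"
    using F by (intro finite_cycles) (simp add: filtration_def)
qed

lemma adjacent_graphcode: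
  assumes "\<alpha> \<in> A" "\<beta> \<in> B"
  shows "adjacent (graphcode p K A B) (Inl \<alpha>) (Inr \<beta>) \<longleftrightarrow>
    coordinate Z2 (cycle_space p K) B \<alpha> \<beta> = 1"
  using assms by (auto simp: adjacent_def graphcode_def doubleton_eq_iff)

text \<open>
  The expansion of \<open>\<alpha>\<close> in the basis of the cycles of \<open>K i\<close> is also its expansion in the larger
  basis \<open>A\<close> of the cycles of \<open>K n\<close>, and the latter is unique.
\<close>

lemma neighbours_born_sum:
  assumes K: "filtration n K" and A: "barcode_basis p n K A" and i: "i \<in> {1..n}"
    and \<alpha>: "\<alpha> \<in> cycles p (K i)"
  shows "{\<beta> \<in> A. coordinate Z2 (cycle_space p (K n)) A \<alpha> \<beta> = 1} \<subseteq>
      {\<beta> \<in> A. already_born p n K \<beta> i}" (is "?N \<subseteq> ?E")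
    and "(\<Sum>\<beta>\<in>{\<beta> \<in> A. coordinate Z2 (cycle_space p (K n)) A \<alpha> \<beta> = 1}. \<beta>) = \<alpha>"
proof -
  have fin: "finite A"
    using finite_barcode_basis[OF K A] .
  have bases: "vectorspace.basis Z2 (cycle_space p (K n)) A"
    "vectorspace.basis Z2 (cycle_space p (K i)) ?E"
    using A i by (auto simp: barcode_basis_def)
  obtain S where S: "S \<subseteq> ?E" "(\<Sum>\<beta>\<in>S. \<beta>) = \<alpha>"
    using basis_cycle_spaceD(2)[OF _ bases(2) \<alpha>] fin by auto
  have SA: "S \<subseteq> A"
    using S(1) by blast
  have AC: "A \<subseteq> cycles p (K n)"
    using basis_cycle_spaceD(1)[OF fin bases(1)] .
  have sum: "(\<Oplus>\<^bsub>cycle_space p (K n)\<^esub>\<beta>\<in>S. \<beta>) = \<alpha>"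
    using finsum_chain_module[OF vectorspace_cycle_space[unfolded cycle_space_def]] SA AC S(2)
    unfolding cycle_space_def by blast
  have \<alpha>': "\<alpha> \<in> carrier (cycle_space p (K n))"
    using basis_cycle_spaceD(3)[OF fin bases(1) SA] S(2)
    by (simp add: cycle_space_def chain_module_def)
  have "?N = S"
    using coordinate_eq_1_iff[OF vectorspace_cycle_space fin bases(1) SA] sum \<alpha>' SA by auto
  with S show "?N \<subseteq> ?E" "(\<Sum>\<beta>\<in>?N. \<beta>) = \<alpha>"
    by auto
qed

text \<open>
  The neighbours of \<open>\<alpha>\<close> are all born at \<open>i\<close> and sum to \<open>\<alpha>\<close>; those already dead are boundaries and
  vanish in homology.
\<close>

lemma hclass_eq_sum_alive_neighbours:
  assumes K: "filtration n K" and A: "barcode_basis p n K A" and i: "i \<in> {1..n}"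
    and \<alpha>: "\<alpha> \<in> cycles p (K i)"
  shows "hclass p (K i) \<alpha> =
    (\<Oplus>\<^bsub>homology p (K i)\<^esub>\<beta>\<in>{\<beta> \<in> A. coordinate Z2 (cycle_space p (K n)) A \<alpha> \<beta> = 1 \<and> alive p n K \<beta> i}.
       hclass p (K i) \<beta>)"
proof -
  let ?N = "{\<beta> \<in> A. coordinate Z2 (cycle_space p (K n)) A \<alpha> \<beta> = 1}"
  let ?E = "{\<beta> \<in> A. already_born p n K \<beta> i}" and ?D = "{\<beta> \<in> A. dead p n K \<beta> i}"
  have fin: "finite A"
    using finite_barcode_basis[OF K A] .
  note N = neighbours_born_sum[OF K A i \<alpha>]
  have bases: "vectorspace.basis Z2 (boundary_space p (K i)) ?D"
    "vectorspace.basis Z2 (cycle_space p (K i)) ?E"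
    using A i by (auto simp: barcode_basis_def)
  have D: "?D \<subseteq> boundaries p (K i)" and E: "?E \<subseteq> cycles p (K i)"
    using basis_boundary_spaceD(1)[OF _ bases(1)] basis_cycle_spaceD(1)[OF _ bases(2)] fin
    by simp_all
  have X: "simplicial_complex (K i)"
    using K i by (simp add: filtration_def)
  have "hclass p (K i) \<alpha> = hclass p (K i) (\<Sum>\<beta>\<in>?N - ?D. \<beta>)"
    using hclass_sum_drop_boundaries[OF _ D, of ?N] N(2) fin by simp
  also have "\<dots> = (\<Oplus>\<^bsub>homology p (K i)\<^esub>\<beta>\<in>?N - ?D. hclass p (K i) \<beta>)"
    using N(1) E by (intro hclass_sum X) auto
  also have "?N - ?D = {\<beta> \<in> A. coordinate Z2 (cycle_space p (K n)) A \<alpha> \<beta> = 1 \<and> alive p n K \<beta> i}"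
    using N(1) by (auto simp: alive_def dead_def)
  finally show ?thesis .
qed

theorem mainTheorem1:
  fixes p n :: nat
    and L K :: "nat \<Rightarrow> 'v set set"
    and A_L A_K :: "'v chain set"
    and G :: "('v chain + 'v chain) set \<times> ('v chain + 'v chain) set set"
  assumes "filtration n L"
    and "filtration n K"
    and "\<forall>i\<in>{1..n}. L i \<subseteq> K i"
    and "carrier (homology p (L n)) = {\<zero>\<^bsub>homology p (L n)\<^esub>}"
    and "carrier (homology p (K n)) = {\<zero>\<^bsub>homology p (K n)\<^esub>}"
    and "barcode_basis p n L A_L"
    and "barcode_basis p n K A_K"
    and "G = graphcode p (K n) A_L A_K"
  shows "\<forall>i\<in>{1..n}.
    inj_on (hclass p (L i)) {\<alpha> \<in> A_L. alive p n L \<alpha> i} \<and>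
    vectorspace.basis Z2 (homology p (L i))
      (hclass p (L i) ` {\<alpha> \<in> A_L. alive p n L \<alpha> i}) \<and>
    (\<forall>\<alpha>\<in>A_L. alive p n L \<alpha> i \<longrightarrow>
       (\<forall>\<beta>\<in>A_K. adjacent G (Inl \<alpha>) (Inr \<beta>) \<longrightarrow> already_born p n K \<beta> i) \<and>
       induced p (L i) (K i) (hclass p (L i) \<alpha>) =
         (\<Oplus>\<^bsub>homology p (K i)\<^esub>
            \<beta> \<in> {\<beta> \<in> A_K. adjacent G (Inl \<alpha>) (Inr \<beta>) \<and> alive p n K \<beta> i}.
            hclass p (K i) \<beta>)) \<and>
    linear_map Z2 (homology p (L i)) (homology p (K i)) (induced p (L i) (K i)) \<and>
    (\<forall>\<psi>. linear_map Z2 (homology p (L i)) (homology p (K i)) \<psi> \<and>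
       (\<forall>\<alpha>\<in>A_L. alive p n L \<alpha> i \<longrightarrow>
          \<psi> (hclass p (L i) \<alpha>) =
            (\<Oplus>\<^bsub>homology p (K i)\<^esub>
               \<beta> \<in> {\<beta> \<in> A_K. adjacent G (Inl \<alpha>) (Inr \<beta>) \<and> alive p n K \<beta> i}.
               hclass p (K i) \<beta>)) \<longrightarrow>
       (\<forall>x\<in>carrier (homology p (L i)). \<psi> x = induced p (L i) (K i) x))"
proof (intro ballI)
  fix i assume i: "i \<in> {1..n}"
  let ?E = "{\<alpha> \<in> A_L. already_born p n L \<alpha> i}" and ?D = "{\<alpha> \<in> A_L. dead p n L \<alpha> i}"
  let ?A = "{\<alpha> \<in> A_L. alive p n L \<alpha> i}"
  let ?N = "\<lambda>\<alpha>. {\<beta> \<in> A_K. adjacent G (Inl \<alpha>) (Inr \<beta>) \<and> alive p n K \<beta> i}"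
  let ?s = "\<lambda>\<alpha>. \<Oplus>\<^bsub>homology p (K i)\<^esub>\<beta>\<in>?N \<alpha>. hclass p (K i) \<beta>"
  have LK: "L i \<subseteq> K i" and X: "simplicial_complex (L i)" "simplicial_complex (K i)"
    using assms(1-3) i by (auto simp: filtration_def)
  have fin: "finite A_L"
    using finite_barcode_basis assms(1,6) by blast
  have bases: "vectorspace.basis Z2 (cycle_space p (L i)) ?E"
    "vectorspace.basis Z2 (boundary_space p (L i)) ?D"
    using assms(6) i by (auto simp: barcode_basis_def)
  note basis = homology_basis[OF X(1) _ bases(1) dead_subset_born[OF assms(1,6) i] bases(2),
      folded alive_eq_born_minus_dead]
  have finE: "finite ?E"
    using fin by simp
  have linear: "linear_map Z2 (homology p (L i)) (homology p (K i)) (induced p (L i) (K i))"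
    using linear_map_induced[OF LK X] .
  have edges: "(\<forall>\<beta>\<in>A_K. adjacent G (Inl \<alpha>) (Inr \<beta>) \<longrightarrow> already_born p n K \<beta> i) \<and>
      induced p (L i) (K i) (hclass p (L i) \<alpha>) = ?s \<alpha>" if \<alpha>: "\<alpha> \<in> ?A" for \<alpha>
  proof -
    have "\<alpha> \<in> cycles p (L i)"
      using \<alpha> basis_cycle_spaceD(1)[OF finE bases(1)] by (auto simp: alive_def)
    then have \<alpha>K: "\<alpha> \<in> cycles p (K i)"
      using cycles_mono[OF LK] by blast
    have adj: "adjacent G (Inl \<alpha>) (Inr \<beta>) \<longleftrightarrow>
        coordinate Z2 (cycle_space p (K n)) A_K \<alpha> \<beta> = 1" if "\<beta> \<in> A_K" for \<beta>
      using \<alpha> that unfolding assms(8) by (intro adjacent_graphcode) auto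
    have "?N \<alpha> = {\<beta> \<in> A_K. coordinate Z2 (cycle_space p (K n)) A_K \<alpha> \<beta> = 1 \<and> alive p n K \<beta> i}"
      using adj by blast
    then have "induced p (L i) (K i) (hclass p (L i) \<alpha>) = ?s \<alpha>"
      using hclass_eq_sum_alive_neighbours[OF assms(2,7) i \<alpha>K] by (simp add: induced_hclass[OF LK])
    then show ?thesis
      using neighbours_born_sum(1)[OF assms(2,7) i \<alpha>K] adj by blast
  qed
  have unique: "\<psi> x = induced p (L i) (K i) x"
    if \<psi>: "linear_map Z2 (homology p (L i)) (homology p (K i)) \<psi>"
      "\<forall>\<alpha>\<in>A_L. alive p n L \<alpha> i \<longrightarrow> \<psi> (hclass p (L i) \<alpha>) = ?s \<alpha>"
      and x: "x \<in> carrier (homology p (L i))" for \<psi> x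
  proof (rule linear_maps_agree[OF \<psi>(1) linear _ basis(2)[OF finE] _ x])
    show "finite (hclass p (L i) ` ?A)"
      using fin by simp
    show "\<psi> c = induced p (L i) (K i) c" if "c \<in> hclass p (L i) ` ?A" for c
      using that \<psi>(2) edges by auto
  qed
  show "inj_on (hclass p (L i)) ?A \<and>
    vectorspace.basis Z2 (homology p (L i)) (hclass p (L i) ` ?A) \<and>
    (\<forall>\<alpha>\<in>A_L. alive p n L \<alpha> i \<longrightarrow>
       (\<forall>\<beta>\<in>A_K. adjacent G (Inl \<alpha>) (Inr \<beta>) \<longrightarrow> already_born p n K \<beta> i) \<and>
       induced p (L i) (K i) (hclass p (L i) \<alpha>) = ?s \<alpha>) \<and>
    linear_map Z2 (homology p (L i)) (homology p (K i)) (induced p (L i) (K i)) \<and>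
    (\<forall>\<psi>. linear_map Z2 (homology p (L i)) (homology p (K i)) \<psi> \<and>
       (\<forall>\<alpha>\<in>A_L. alive p n L \<alpha> i \<longrightarrow> \<psi> (hclass p (L i) \<alpha>) = ?s \<alpha>) \<longrightarrow>
       (\<forall>x\<in>carrier (homology p (L i)). \<psi> x = induced p (L i) (K i) x))"
  proof (intro conjI ballI allI impI)
    show "\<psi> x = induced p (L i) (K i) x"
      if "linear_map Z2 (homology p (L i)) (homology p (K i)) \<psi> \<and>
          (\<forall>\<alpha>\<in>A_L. alive p n L \<alpha> i \<longrightarrow> \<psi> (hclass p (L i) \<alpha>) = ?s \<alpha>)"
        "x \<in> carrier (homology p (L i))" for \<psi> x
      using that by (intro unique) simp_all
  qed (use basis[OF finE] linear edges in blast)+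
qed

end
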